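(* For $\rho\ge1/\sin(1/2)$ let $\alpha=\arcsin(1/\rho)$, $v=(2\cos\alpha-\cos2\alpha)\csc2\alpha$, $$\overline\beta(\rho)=\arctan\left(\frac{-v+\sqrt{v^2-\left(\tfrac94\cos^2\alpha-1\right)\left(\tfrac54-v^2\right)}}{\tfrac94\cos^2\alpha-1}\right),\qquad \overline\gamma(\rho)=\arccos\left(\tfrac43\cos(\alpha+\overline\beta(\rho))\right),$$ and let $\mathcal E^\rho_\infty(\overline\beta,\overline\gamma)$ denote the energy of $\infty$-$\mathrm{RB}_{\overline\beta(\rho),\overline\gamma(\rho)}$ in $\mathrm{SRD}^\rho$. Then $$\lim_{\rho\to\infty}\frac{\mathcal E^\rho_\infty(\overline\beta,\overline\gamma)}{\rho^2}=\frac{18}{79}.$$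
   Context: Symmetric Rendezvous in a Disk, $\mathrm{SRD}^\rho$ ($\rho>\sqrt2$): two robots start on a circle of radius $\rho$ centred at a known reference point $O$, at Euclidean distance $2$; each knows $O$, $\rho$ and the distance but not which of the two possible positions is the peer's. Robots move with speed at most $1$, run the same synchronized randomized algorithm with independent random bits, and meet only when at the same point at the same time. Set $\alpha=\arcsin(1/\rho)$ (angular distance of the robots is $2\alpha$). The energy of an algorithm is the supremum of the time by when the rendezvous is realized with probability $1$, i.e. the least $T$ (possibly $\infty$) such that rendezvous has occurred by time $T$ almost surely. Moves: for a robot at $A$ with $|OA|=r>0$, a direction (clockwise/counterclockwise), an angle $\phi\in\{\alpha,2\alpha\}$ and $\theta\in[0,\pi/2)$, let $L$ be the ray from $O$ obtained by rotating ray $OA$ by $\phi$ in that direction; the robot walks straight from $A$ to the point $P\in L$ with $\angle OAP=\theta$ ($P=O$ if $\theta=0$). A $\beta$-darting is this move with $\phi=\alpha,\theta=\beta$; a random $\beta$-darting uses an independent fair coin for the direction. A $\gamma$-darting in the opposite direction is the move with $\phi=2\alpha,\theta=\gamma$ in the direction opposite to the one just used. Algorithm $\infty$-$\mathrm{RB}_{\beta,\gamma}$: repeat forever: a random $\beta$-darting, then a $\gamma$-darting in the opposite direction; robots stop upon meeting. *)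

theory Defs
  imports "HOL-Probability.Probability"
begin

text \<open>
  The plane is the type of complex numbers and the reference point \<open>O\<close> is \<open>0\<close>.
  The coin value \<open>True\<close> stands for the counterclockwise direction.
\<close>

definition half_dist_angle :: "real \<Rightarrow> real" where
  "half_dist_angle \<rho> = arcsin (1 / \<rho>)"

text \<open>The angle at the vertex \<open>B\<close> between the segments \<open>BA\<close> and \<open>BC\<close>.\<close>

definition angle3 :: "complex \<Rightarrow> complex \<Rightarrow> complex \<Rightarrow> real" where
  "angle3 A B C = arccos (((A - B) \<bullet> (C - B)) / (norm (A - B) * norm (C - B)))"

definition rotated_ray :: "bool \<Rightarrow> real \<Rightarrow> complex \<Rightarrow> complex set" where
  "rotated_ray d \<phi> A = {s *\<^sub>R (cis (if d then \<phi> else - \<phi>) * A) | s. 0 \<le> s}"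

text \<open>
  For \<open>A \<noteq> 0\<close>, \<open>0 < \<phi> < pi\<close> and \<open>0 \<le> \<theta> < pi - \<phi>\<close> the point described here exists and is unique.
  For \<open>\<theta> = 0\<close> it is \<open>0\<close>. A robot situated at \<open>0\<close> has no move.
\<close>

definition dart :: "bool \<Rightarrow> real \<Rightarrow> real \<Rightarrow> complex \<Rightarrow> complex" where
  "dart d \<phi> \<theta> A = (THE P. P \<in> rotated_ray d \<phi> A \<and> angle3 0 A P = \<theta>)"

text \<open>
  Successive endpoints of the moves of a robot that starts at \<open>A\<close> and uses the coin \<open>c k\<close> in
  round \<open>k\<close>; moves \<open>2 * k\<close> and \<open>2 * k + 1\<close> form that round.
\<close>

primrec waypoint :: "real \<Rightarrow> real \<Rightarrow> real \<Rightarrow> complex \<Rightarrow> (nat \<Rightarrow> bool) \<Rightarrow> nat \<Rightarrow> complex" where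
  "waypoint \<alpha> \<beta> \<gamma> A c 0 = A"
| "waypoint \<alpha> \<beta> \<gamma> A c (Suc n) =
     (if even n then dart (c (n div 2)) \<alpha> \<beta> (waypoint \<alpha> \<beta> \<gamma> A c n)
      else dart (\<not> c (n div 2)) (2 * \<alpha>) \<gamma> (waypoint \<alpha> \<beta> \<gamma> A c n))"

definition arrival :: "real \<Rightarrow> real \<Rightarrow> real \<Rightarrow> complex \<Rightarrow> (nat \<Rightarrow> bool) \<Rightarrow> nat \<Rightarrow> real" where
  "arrival \<alpha> \<beta> \<gamma> A c n =
     (\<Sum>i<n. dist (waypoint \<alpha> \<beta> \<gamma> A c i) (waypoint \<alpha> \<beta> \<gamma> A c (Suc i)))"

text \<open>
  The robot is at \<open>p\<close> at time \<open>t\<close>, walking at unit speed. If the total length of its moves is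
  finite, it has no position once that time has elapsed.
\<close>

definition located ::
  "real \<Rightarrow> real \<Rightarrow> real \<Rightarrow> complex \<Rightarrow> (nat \<Rightarrow> bool) \<Rightarrow> real \<Rightarrow> complex \<Rightarrow> bool" where
  "located \<alpha> \<beta> \<gamma> A c t p \<longleftrightarrow>
     (\<exists>n. arrival \<alpha> \<beta> \<gamma> A c n \<le> t \<and> t \<le> arrival \<alpha> \<beta> \<gamma> A c (Suc n) \<and>
          p = waypoint \<alpha> \<beta> \<gamma> A c n + (t - arrival \<alpha> \<beta> \<gamma> A c n) *\<^sub>R
                sgn (waypoint \<alpha> \<beta> \<gamma> A c (Suc n) - waypoint \<alpha> \<beta> \<gamma> A c n))"

text \<open>
  Stopping upon meeting does not change the first meeting time, so the robots are simply
  followed along their uninterrupted trajectories.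
\<close>

definition rendezvous_by ::
  "real \<Rightarrow> real \<Rightarrow> real \<Rightarrow> complex \<Rightarrow> complex \<Rightarrow> real \<Rightarrow> (nat \<Rightarrow> bool) \<times> (nat \<Rightarrow> bool) \<Rightarrow> bool" where
  "rendezvous_by \<alpha> \<beta> \<gamma> A B T \<omega> \<longleftrightarrow>
     (\<exists>t\<le>T. \<exists>p. located \<alpha> \<beta> \<gamma> A (fst \<omega>) t p \<and> located \<alpha> \<beta> \<gamma> B (snd \<omega>) t p)"

definition fair_coins :: "(nat \<Rightarrow> bool) measure" where
  "fair_coins = PiM UNIV (\<lambda>_. measure_pmf (bernoulli_pmf (1 / 2)))"

text \<open>
  The two components of the product are the independent random bits of the two robots. The bound
  is required for every admissible initial placement. The energy is \<open>\<infinity>\<close> if there is no such bound.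
\<close>

definition RB_energy :: "real \<Rightarrow> real \<Rightarrow> real \<Rightarrow> ereal" where
  "RB_energy \<rho> \<beta> \<gamma> =
     (INF T\<in>{T. \<forall>A B. norm A = \<rho> \<and> norm B = \<rho> \<and> dist A B = 2 \<longrightarrow>
                  (AE \<omega> in fair_coins \<Otimes>\<^sub>M fair_coins.
                     rendezvous_by (half_dist_angle \<rho>) \<beta> \<gamma> A B T \<omega>)}. ereal T)"

definition v_coeff :: "real \<Rightarrow> real" where
  "v_coeff \<alpha> = (2 * cos \<alpha> - cos (2 * \<alpha>)) * (1 / sin (2 * \<alpha>))"

definition beta_bar :: "real \<Rightarrow> real" where
  "beta_bar \<rho> = (let \<alpha> = half_dist_angle \<rho>; v = v_coeff \<alpha>; q = 9 / 4 * (cos \<alpha>)\<^sup>2 - 1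
     in arctan ((- v + sqrt (v\<^sup>2 - q * (5 / 4 - v\<^sup>2))) / q))"

definition gamma_bar :: "real \<Rightarrow> real" where
  "gamma_bar \<rho> = arccos (4 / 3 * cos (half_dist_angle \<rho> + beta_bar \<rho>))"

end

theory Submission imports Defs "HOL-Real_Asymp.Real_Asymp" begin

text \<open>
  Two robots that flip equal coins in a round only rotate by a common angle about \<open>O\<close> and shrink
  towards it by a common factor, so they keep their angular distance \<open>2 * \<alpha>\<close>; two robots that flip
  different coins meet in the middle, at the end of the first move if they move towards each
  other and at the end of the second one otherwise. Equal coins in the first \<open>k\<close> rounds have positive
  probability for every \<open>k\<close>, so the energy is the total length of the infinite path, a geometric
  series. As \<open>\<alpha>\<close> tends to \<open>0\<close>, one has \<open>cos \<beta> \<sim> 5 * \<alpha>\<close> and \<open>cos \<gamma> \<sim> 16 / 3 * \<alpha>\<close>. A round then has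
  length \<open>\<sim> 3 * \<alpha>\<close> times the initial radius, and the radius contracts by
  \<open>1 - (9 / 2 + 26 / 3) * \<alpha>\<^sup>2 = 1 - 79 / 6 * \<alpha>\<^sup>2\<close> up to lower order, which gives
  \<open>\<rho> * 3 * \<alpha> / (79 / 6 * \<alpha>\<^sup>2) \<sim> 18 / 79 * \<rho>\<^sup>2\<close>.
\<close>

section \<open>Geometry of a single dart and of the initial placement\<close>

definition dir :: "bool \<Rightarrow> real" where
  "dir d = (if d then 1 else - 1)"

text \<open>Law of sines in the triangle OAP with angle \<phi> at O and \<theta> at A: this is the
  ratio of OP to OA, and \<open>reach\<close> below is the ratio of AP to OA.\<close>

definition shrink :: "real \<Rightarrow> real \<Rightarrow> real" where
  "shrink \<phi> \<theta> = sin \<theta> / sin (\<phi> + \<theta>)"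

definition reach :: "real \<Rightarrow> real \<Rightarrow> real" where
  "reach \<phi> \<theta> = sin \<phi> / sin (\<phi> + \<theta>)"

lemma norm_scaled_cis_minus_1:
  fixes s \<psi> :: real
  shows "norm (of_real s * cis \<psi> - 1) = sqrt ((1 - s * cos \<psi>)\<^sup>2 + (s * sin \<psi>)\<^sup>2)"
  by (simp add: cmod_def power2_commute)

text \<open>Multiplication by \<open>A\<close> is a similarity, so it leaves the angle unchanged;
  this normalises the triangle to the vertices 0, 1 and
  \<open>of_real s * cis \<psi>\<close>.\<close>

lemma angle3_scaled_cis:
  fixes s \<psi> :: real
  assumes "A \<noteq> 0"
  shows "angle3 0 A (of_real s * cis \<psi> * A) =
    arccos ((1 - s * cos \<psi>) / sqrt ((1 - s * cos \<psi>)\<^sup>2 + (s * sin \<psi>)\<^sup>2))"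
proof -
  define z where "z = of_real s * cis \<psi> - 1"
  have P: "of_real s * cis \<psi> * A - A = A * z"
    by (simp add: z_def algebra_simps)
  have "(0 - A) \<bullet> (A * z) = (norm A)\<^sup>2 * (- Re z)"
    unfolding cmod_power2 by (simp add: inner_complex_def algebra_simps power2_eq_square)
  also have "- Re z = 1 - s * cos \<psi>"
    by (simp add: z_def)
  finally have "(0 - A) \<bullet> (A * z) / (norm (0 - A) * norm (A * z)) = (1 - s * cos \<psi>) / norm z"
    using assms by (simp add: norm_mult power2_eq_square)
  then show ?thesis
    unfolding angle3_def P z_def norm_scaled_cis_minus_1 by simp
qed

text \<open>In the normalised triangle the side leaving 1 has components
  \<open>reach \<phi> \<theta> * cos \<theta>\<close> towards 0 and
  \<open>reach \<phi> \<theta> * sin \<theta>\<close> across. The sign \<open>s\<close> covers both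
  directions of rotation.\<close>

lemma norm_shrink_cis_minus_1:
  assumes "0 < \<phi>" "0 < \<theta>" "\<phi> + \<theta> < pi" "\<bar>s\<bar> = (1::real)"
  shows "norm (of_real (shrink \<phi> \<theta>) * cis (s * \<phi>) - 1) = reach \<phi> \<theta>"
    and "1 - shrink \<phi> \<theta> * cos \<phi> = reach \<phi> \<theta> * cos \<theta>"
proof -
  have pos: "sin (\<phi> + \<theta>) > 0" "sin \<phi> > 0"
    using assms by (auto intro!: sin_gt_zero)
  show c: "1 - shrink \<phi> \<theta> * cos \<phi> = reach \<phi> \<theta> * cos \<theta>"
    using pos by (simp add: shrink_def reach_def field_simps sin_add)
  have *: "shrink \<phi> \<theta> * sin \<phi> = reach \<phi> \<theta> * sin \<theta>"
    by (simp add: shrink_def reach_def)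
  have s: "cos (s * \<phi>) = cos \<phi>" "(sin (s * \<phi>))\<^sup>2 = (sin \<phi>)\<^sup>2"
    using assms(4) by (auto simp: abs_if minus_equation_iff[of s] split: if_splits)
  have "(shrink \<phi> \<theta> * sin (s * \<phi>))\<^sup>2 = (shrink \<phi> \<theta> * sin \<phi>)\<^sup>2"
    by (simp only: power_mult_distrib s(2))
  also have "\<dots> = (reach \<phi> \<theta> * sin \<theta>)\<^sup>2"
    by (simp only: *)
  finally have "(1 - shrink \<phi> \<theta> * cos (s * \<phi>))\<^sup>2 + (shrink \<phi> \<theta> * sin (s * \<phi>))\<^sup>2 =
      (reach \<phi> \<theta>)\<^sup>2 * ((cos \<theta>)\<^sup>2 + (sin \<theta>)\<^sup>2)"
    unfolding s(1) c by (simp only: power_mult_distrib distrib_left)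
  then show "norm (of_real (shrink \<phi> \<theta>) * cis (s * \<phi>) - 1) = reach \<phi> \<theta>"
    unfolding norm_scaled_cis_minus_1 using pos by (simp add: reach_def)
qed

text \<open>\<open>THE\<close> requires uniqueness as well as existence. A point of the ray is given
  by one scale \<open>s\<close>, and the angle condition turns into an equation linear in
  \<open>s\<close> with coefficient \<open>sin (\<phi> + \<theta>)\<close>, which is
  positive.\<close>

lemma dart_eq:
  assumes "A \<noteq> 0" "0 < \<phi>" "0 < \<theta>" "\<phi> + \<theta> < pi"
  shows "dart d \<phi> \<theta> A = of_real (shrink \<phi> \<theta>) * cis (dir d * \<phi>) * A"
proof -
  have pos: "sin (\<phi> + \<theta>) > 0" "sin \<phi> > 0" "sin \<theta> > 0"
    using assms by (auto intro!: sin_gt_zero)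
  have dir: "(if d then \<phi> else - \<phi>) = dir d * \<phi>" "\<bar>dir d\<bar> = 1"
    by (auto simp: dir_def)
  have cd: "cos (dir d * \<phi>) = cos \<phi>" "(sin (dir d * \<phi>))\<^sup>2 = (sin \<phi>)\<^sup>2"
    by (auto simp: dir_def)
  note norms = norm_shrink_cis_minus_1[OF assms(2-4) dir(2)]
  show ?thesis
    unfolding dart_def
  proof (rule the_equality)
    have "angle3 0 A (of_real (shrink \<phi> \<theta>) * cis (dir d * \<phi>) * A) = arccos (cos \<theta>)"
      unfolding angle3_scaled_cis[OF assms(1)] unfolding norm_scaled_cis_minus_1[symmetric]
      unfolding norms(1) cd norms(2)
      using pos by (simp add: reach_def)
    then show "of_real (shrink \<phi> \<theta>) * cis (dir d * \<phi>) * A \<in> rotated_ray d \<phi> A \<and>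
        angle3 0 A (of_real (shrink \<phi> \<theta>) * cis (dir d * \<phi>) * A) = \<theta>"
      using assms pos unfolding rotated_ray_def dir
      by (auto simp: arccos_cos shrink_def scaleR_conv_of_real mult.assoc
          intro!: exI[of _ "sin \<theta> / sin (\<phi> + \<theta>)"])
  next
    fix P assume P: "P \<in> rotated_ray d \<phi> A \<and> angle3 0 A P = \<theta>"
    then obtain s where s: "s \<ge> 0" "P = of_real s * cis (dir d * \<phi>) * A"
      by (auto simp: rotated_ray_def dir scaleR_conv_of_real mult.assoc)
    define u w r where "u = 1 - s * cos \<phi>" and "w = s * sin \<phi>" and "r = sqrt (u\<^sup>2 + w\<^sup>2)"
    have w: "w \<ge> 0"
      using s pos by (simp add: w_def)
    \<comment> \<open>If \<open>w = 0\<close> then \<open>s = 0\<close>, because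
      \<open>sin \<phi>\<close> is positive, and then \<open>u = 1\<close>.\<close>
    have "w \<noteq> 0 \<or> u \<noteq> 0"
      using pos by (auto simp: w_def u_def)
    then have r: "r > 0"
      unfolding r_def by (metis real_sqrt_gt_zero sum_power2_gt_zero_iff)
    have r2: "r\<^sup>2 = u\<^sup>2 + w\<^sup>2"
      by (simp add: r_def)
    have "\<bar>u\<bar> \<le> r"
      by (simp add: r_def)
    then have "- 1 \<le> u / r" "u / r \<le> 1"
      using r by (auto simp: field_simps)
    moreover have "arccos (u / r) = \<theta>"
      using P s by (simp add: angle3_scaled_cis[OF assms(1)] cd u_def w_def r_def power_mult_distrib)
    ultimately have cos: "cos \<theta> = u / r"
      by (metis cos_arccos)
    \<comment> \<open>The angle fixes only the cosine, hence the sine up to sign; the root is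
      selected by \<open>w \<ge> 0\<close> together with \<open>sin \<theta> > 0\<close>.\<close>
    have "(sin \<theta>)\<^sup>2 = (w / r)\<^sup>2"
      using r by (simp add: sin_squared_eq cos power_divide r2[symmetric] diff_divide_eq_iff) (simp add: r2)
    then have "sin \<theta> = w / r"
      using pos w r by (simp add: power2_eq_iff_nonneg)
    then have "w * cos \<theta> = u * sin \<theta>"
      by (simp add: cos)
    then have "s * sin (\<phi> + \<theta>) = sin \<theta>"
      by (simp add: w_def u_def sin_add algebra_simps)
    then have "s = shrink \<phi> \<theta>"
      using pos by (simp add: shrink_def field_simps)
    then show "P = of_real (shrink \<phi> \<theta>) * cis (dir d * \<phi>) * A"
      using s by simp
  qed
qed

text \<open>The quotient \<open>u = B / A\<close> lies on the unit circle at distance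
  \<open>2 * sin \<alpha>\<close> from 1. This fixes its real part as
  \<open>cos (2 * \<alpha>)\<close> and its imaginary part up to sign; the sign is the choice of
  \<open>d\<close>.\<close>

lemma peer_position:
  assumes "1 \<le> \<rho>" "norm A = \<rho>" "norm B = \<rho>" "dist A B = 2"
  obtains d where "B = cis (dir d * (2 * half_dist_angle \<rho>)) * A"
proof -
  define \<alpha> where "\<alpha> = half_dist_angle \<rho>"
  have sin: "sin \<alpha> = 1 / \<rho>"
    using assms(1) unfolding \<alpha>_def half_dist_angle_def by (intro sin_arcsin) (auto intro: order_trans[of _ 0])
  define u where "u = B / A"
  have A: "A \<noteq> 0"
    using assms by auto
  then have B: "B = u * A"
    by (simp add: u_def)
  have u: "norm u = 1"
    using assms A by (simp add: u_def norm_divide)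
  have "norm (u - 1) * norm A = dist A B"
    unfolding B dist_norm by (subst norm_minus_commute) (simp add: algebra_simps flip: norm_mult)
  then have "norm (u - 1) = 2 * sin \<alpha>"
    using assms by (simp add: sin field_simps)
  then have "(norm (u - 1))\<^sup>2 = 4 * (sin \<alpha>)\<^sup>2"
    by (simp add: power_mult_distrib)
  then have "(Re u)\<^sup>2 - 2 * Re u + 1 + (Im u)\<^sup>2 = 4 * (sin \<alpha>)\<^sup>2"
    unfolding cmod_power2 by (simp add: power2_eq_square algebra_simps)
  moreover have n: "(Re u)\<^sup>2 + (Im u)\<^sup>2 = 1"
    using u by (simp flip: cmod_power2)
  ultimately have Re: "Re u = cos (2 * \<alpha>)"
    by (simp add: cos_double_sin)
  then have "(Im u)\<^sup>2 = (sin (2 * \<alpha>))\<^sup>2"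
    using n by (simp add: sin_squared_eq)
  then have "Im u = sin (2 * \<alpha>) \<or> Im u = - sin (2 * \<alpha>)"
    by (simp add: power2_eq_iff)
  then have "u = cis (dir True * (2 * \<alpha>)) \<or> u = cis (dir False * (2 * \<alpha>))"
    using Re by (auto simp: dir_def complex_eq_iff)
  then show thesis
    using that B unfolding \<alpha>_def by blast
qed

section \<open>Probability of agreeing coin sequences\<close>

lemma emeasure_coin: "emeasure (measure_pmf (bernoulli_pmf (1 / 2))) {b} = ennreal (1 / 2)"
  by (cases b) (simp_all add: emeasure_pmf_single)

lemma emeasure_fair_coins_prefix:
  "emeasure fair_coins {y. \<forall>k<n. y k = x k} = ennreal ((1 / 2) ^ n)"
proof -
  \<comment> \<open>As a cylinder over a finite box, the event has a finite product of coin
    probabilities as its measure.\<close>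
  have "{y. \<forall>k<n. y k = x k} =
      prod_emb UNIV (\<lambda>_. measure_pmf (bernoulli_pmf (1 / 2))) {..<n} (\<Pi>\<^sub>E k\<in>{..<n}. {x k})"
    by (auto simp: prod_emb_PiE_same_index prod_emb_def restrict_def PiE_iff fun_eq_iff extensional_def)
  then have "emeasure fair_coins {y. \<forall>k<n. y k = x k} =
      (\<Prod>k<n. emeasure (measure_pmf (bernoulli_pmf (1 / 2))) {x k})"
    unfolding fair_coins_def
    by (simp only:) (intro emeasure_PiM_emb, auto simp: measure_pmf.prob_space_axioms)
  also have "\<dots> = ennreal (1 / 2) ^ n"
    unfolding emeasure_coin by (simp only: prod_constant card_lessThan)
  also have "\<dots> = ennreal ((1 / 2) ^ n)"
    by (rule ennreal_power) simp
  finally show ?thesis .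
qed

lemma space_fair_coins [simp]: "space fair_coins = UNIV"
  by (simp add: fair_coins_def space_PiM)

lemma prob_space_fair_coins: "prob_space fair_coins"
  unfolding fair_coins_def by (intro prob_space_PiM measure_pmf.prob_space_axioms)

lemma measurable_fair_coin [measurable]:
  "(\<lambda>y. y k) \<in> measurable fair_coins (count_space UNIV)"
  using measurable_component_singleton[of k UNIV "\<lambda>_. measure_pmf (bernoulli_pmf (1 / 2))"]
  unfolding fair_coins_def by (simp cong: measurable_cong_sets)

text \<open>For fixed \<open>x\<close>, the sequences that never differ from \<open>x\<close> lie in
  prefix events of measure \<open>(1 / 2) ^ n\<close> for every \<open>n\<close>, hence form a null
  set; \<open>AE_pair_measure\<close> passes from the sections to the product.\<close>

lemma AE_coins_differ:
  "AE \<omega> in fair_coins \<Otimes>\<^sub>M fair_coins. \<exists>k. fst \<omega> k \<noteq> snd \<omega> k"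
proof -
  interpret prob_space fair_coins
    by (rule prob_space_fair_coins)
  interpret pair_prob_space fair_coins fair_coins ..
  have "AE y in fair_coins. \<exists>k. x k \<noteq> y k" for x
  proof -
    define N where "N = {y. \<forall>k. y k = x k}"
    have "emeasure fair_coins N \<le> ennreal ((1 / 2) ^ n)" for n
    proof -
      \<comment> \<open>Since \<open>emeasure\<close> is 0 off the sigma-algebra, a nonzero value
        already proves measurability.\<close>
      have "{y. \<forall>k<n. y k = x k} \<in> sets fair_coins"
        by (intro emeasure_neq_0_sets) (simp add: emeasure_fair_coins_prefix)
      then have "emeasure fair_coins N \<le> emeasure fair_coins {y. \<forall>k<n. y k = x k}"
        by (intro emeasure_mono) (auto simp: N_def)
      then show ?thesis
        by (simp add: emeasure_fair_coins_prefix)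
    qed
    moreover have "(\<lambda>n. ennreal ((1 / 2) ^ n)) \<longlonglongrightarrow> ennreal 0"
      by (intro tendsto_ennrealI LIMSEQ_realpow_zero) auto
    ultimately have "emeasure fair_coins N \<le> 0"
      by (intro LIMSEQ_le_const[of "\<lambda>n. ennreal ((1 / 2) ^ n)"]) auto
    moreover have "N \<in> sets fair_coins"
    proof -
      have "{y \<in> space fair_coins. \<forall>k. y k = x k} \<in> sets fair_coins"
        by measurable
      then show ?thesis
        by (simp add: N_def)
    qed
    ultimately have "N \<in> null_sets fair_coins"
      by (auto simp: null_sets_def)
    then show ?thesis
      by (rule AE_I') (auto simp: N_def)
  qed
  then show ?thesis
    by (intro AE_pair_measure) (simp_all, measurable)
qed

text \<open>An almost sure property cannot miss an event of positive probability. The event used is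
  that both prefixes of length \<open>n\<close> consist of \<open>True\<close> only, of probability
  \<open>(1 / 4) ^ n\<close>. This serves the lower bound on the energy.\<close>

lemma AE_fair_coins_witness:
  assumes "AE \<omega> in fair_coins \<Otimes>\<^sub>M fair_coins. P \<omega>"
  obtains \<omega> where "P \<omega>" "\<And>k. k < n \<Longrightarrow> fst \<omega> k = snd \<omega> k"
proof -
  interpret prob_space fair_coins
    by (rule prob_space_fair_coins)
  define S :: "(nat \<Rightarrow> bool) set" where "S = {y. \<forall>k<n. y k = True}"
  have S: "emeasure fair_coins S = ennreal ((1 / 2) ^ n)"
    unfolding S_def by (rule emeasure_fair_coins_prefix)
  then have "S \<in> sets fair_coins"
    by (intro emeasure_neq_0_sets) auto
  then have SS: "S \<times> S \<in> sets (fair_coins \<Otimes>\<^sub>M fair_coins)"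
      "emeasure (fair_coins \<Otimes>\<^sub>M fair_coins) (S \<times> S) \<noteq> 0"
    by (auto simp: emeasure_pair_measure_Times S)
  obtain N where N: "N \<in> null_sets (fair_coins \<Otimes>\<^sub>M fair_coins)"
      "{\<omega> \<in> space (fair_coins \<Otimes>\<^sub>M fair_coins). \<not> P \<omega>} \<subseteq> N"
    using assms by (auto simp: eventually_ae_filter)
  have "\<not> S \<times> S \<subseteq> N"
    using N(1) SS null_sets_subset by (metis null_setsD1)
  then obtain \<omega> where "\<omega> \<in> S \<times> S" "\<omega> \<notin> N"
    by auto
  moreover have "\<omega> \<in> space (fair_coins \<Otimes>\<^sub>M fair_coins)"
    by (simp add: space_pair_measure)
  ultimately show thesis
    using N(2) by (intro that[of \<omega>]) (auto simp: S_def)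
qed

section \<open>The two angles as \<alpha> tends to 0\<close>

text \<open>The angle \<open>beta_bar\<close> as a function of \<alpha>, so that limits can be taken
  at \<open>at_right 0\<close> and pulled back to \<rho> at the end.\<close>

definition beta_of :: "real \<Rightarrow> real" where
  "beta_of \<alpha> = (let v = v_coeff \<alpha>; q = 9 / 4 * (cos \<alpha>)\<^sup>2 - 1
     in arctan ((- v + sqrt (v\<^sup>2 - q * (5 / 4 - v\<^sup>2))) / q))"

definition gamma_of :: "real \<Rightarrow> real" where
  "gamma_of \<alpha> = arccos (4 / 3 * cos (\<alpha> + beta_of \<alpha>))"

text \<open>To leading order \<open>v\<close> is \<open>1 / (2 * \<alpha>)\<close> and
  \<open>q\<close> tends to 5/4. The discriminant \<open>v\<^sup>2 * (1 + q) - 5 / 4 * q\<close> is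
  then about \<open>9 / 4 * v\<^sup>2\<close>, so the tangent is about
  \<open>(v / 2) / (5 / 4)\<close>, that is \<open>1 / (5 * \<alpha>)\<close>.\<close>

lemma tan_beta_of_asymp: "((\<lambda>\<alpha>. \<alpha> * tan (beta_of \<alpha>)) \<longlongrightarrow> 1 / 5) (at_right 0)"
proof -
  have "((\<lambda>\<alpha>. \<alpha> * ((- v_coeff \<alpha> +
        sqrt ((v_coeff \<alpha>)\<^sup>2 - (9 / 4 * (cos \<alpha>)\<^sup>2 - 1) * (5 / 4 - (v_coeff \<alpha>)\<^sup>2))) / (9 / 4 * (cos \<alpha>)\<^sup>2 - 1)))
      \<longlongrightarrow> 1 / 5) (at_right 0)"
    unfolding v_coeff_def
    by real_asymp (simp add: powr_half_sqrt real_sqrt_divide power2_eq_square)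
  then show ?thesis
    by (simp add: beta_of_def Let_def tan_arctan)
qed

lemma cos_beta_of_asymp: "((\<lambda>\<alpha>. cos (beta_of \<alpha>) / \<alpha>) \<longlongrightarrow> 5) (at_right 0)"
proof -
  \<comment> \<open>This is \<open>cos (arctan x) = 1 / sqrt (1 + x\<^sup>2)\<close> with the factor
    \<alpha> moved under the root, where everything converges.\<close>
  have "((\<lambda>\<alpha>. 1 / sqrt (\<alpha>\<^sup>2 + (\<alpha> * tan (beta_of \<alpha>))\<^sup>2)) \<longlongrightarrow> 1 / sqrt (0\<^sup>2 + (1 / 5)\<^sup>2)) (at_right 0)"
    by (intro tendsto_intros tan_beta_of_asymp) auto
  moreover have "\<forall>\<^sub>F \<alpha>::real in at_right 0. 1 / sqrt (\<alpha>\<^sup>2 + (\<alpha> * tan (beta_of \<alpha>))\<^sup>2) = cos (beta_of \<alpha>) / \<alpha>"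
    using eventually_at_right_less
  proof eventually_elim
    case (elim \<alpha>)
    have "sqrt (\<alpha>\<^sup>2 + (\<alpha> * tan (beta_of \<alpha>))\<^sup>2) = sqrt (\<alpha>\<^sup>2 * (1 + (tan (beta_of \<alpha>))\<^sup>2))"
      by (simp add: algebra_simps power_mult_distrib)
    also have "\<dots> = \<alpha> * sqrt (1 + (tan (beta_of \<alpha>))\<^sup>2)"
      using elim by (simp add: real_sqrt_mult)
    finally show ?case
      by (simp add: beta_of_def Let_def tan_arctan cos_arctan)
  qed
  ultimately show ?thesis
    by (simp add: tendsto_cong power_divide real_sqrt_divide)
qed

lemma sin_over_id: "((\<lambda>\<alpha>::real. sin \<alpha> / \<alpha>) \<longlongrightarrow> 1) (at_right 0)"
  by real_asymp

lemma sin_beta_of_asymp: "((\<lambda>\<alpha>. sin (beta_of \<alpha>)) \<longlongrightarrow> 1) (at_right 0)"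
proof -
  have "((\<lambda>\<alpha>. \<alpha> * tan (beta_of \<alpha>) * (cos (beta_of \<alpha>) / \<alpha>)) \<longlongrightarrow> 1 / 5 * 5) (at_right 0)"
    by (intro tendsto_intros tan_beta_of_asymp cos_beta_of_asymp)
  moreover have "\<forall>\<^sub>F \<alpha>::real in at_right 0. \<alpha> * tan (beta_of \<alpha>) * (cos (beta_of \<alpha>) / \<alpha>) = sin (beta_of \<alpha>)"
    using eventually_at_right_less
    by eventually_elim (simp add: tan_def beta_of_def Let_def)
  ultimately show ?thesis
    by (simp add: tendsto_cong)
qed

lemma tendsto_zero_if_quotient:
  assumes "((\<lambda>\<alpha>::real. f \<alpha> / \<alpha>) \<longlongrightarrow> (c::real)) (at_right 0)"
  shows "(f \<longlongrightarrow> 0) (at_right 0)"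
proof -
  have "((\<lambda>\<alpha>. f \<alpha> / \<alpha> * \<alpha>) \<longlongrightarrow> c * 0) (at_right 0)"
    by (intro tendsto_intros assms)
  moreover have "\<forall>\<^sub>F \<alpha>::real in at_right 0. f \<alpha> / \<alpha> * \<alpha> = f \<alpha>"
    using eventually_at_right_less by eventually_elim simp
  ultimately show ?thesis
    by (simp add: tendsto_cong)
qed

text \<open>By the addition formula \<open>cos (\<alpha> + beta_of \<alpha>)\<close> is about
  \<open>5 * \<alpha> - \<alpha>\<close>.\<close>

lemma cos_sum_beta_of_asymp: "((\<lambda>\<alpha>. 4 / 3 * cos (\<alpha> + beta_of \<alpha>) / \<alpha>) \<longlongrightarrow> 16 / 3) (at_right 0)"
proof -
  have cos0: "((\<lambda>\<alpha>::real. cos \<alpha>) \<longlongrightarrow> 1) (at_right 0)"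
    by real_asymp
  have "((\<lambda>\<alpha>. 4 / 3 * (cos \<alpha> * (cos (beta_of \<alpha>) / \<alpha>) - sin \<alpha> / \<alpha> * sin (beta_of \<alpha>)))
      \<longlongrightarrow> 4 / 3 * (1 * 5 - 1 * 1)) (at_right 0)"
    by (intro tendsto_intros cos0 cos_beta_of_asymp sin_over_id sin_beta_of_asymp)
  then show ?thesis
    by (simp add: cos_add diff_divide_distrib right_diff_distrib)
qed

lemma arctan_tan_beta_of: "arctan (tan (beta_of \<alpha>)) = beta_of \<alpha>"
  by (simp add: beta_of_def Let_def tan_arctan)

lemma eventually_beta_of_pos: "\<forall>\<^sub>F \<alpha> in at_right 0. 0 < beta_of \<alpha>"
proof -
  have "\<forall>\<^sub>F \<alpha> in at_right 0. \<alpha> * tan (beta_of \<alpha>) > 0"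
    using tan_beta_of_asymp by (rule order_tendstoD) simp
  with eventually_at_right_less[of 0] show ?thesis
    by eventually_elim (metis arctan_tan_beta_of zero_less_arctan_iff zero_less_mult_pos)
qed

lemma beta_of_less: "beta_of \<alpha> < pi / 2"
  unfolding beta_of_def Let_def by (rule arctan_ubound)

text \<open>For small \<alpha> the argument of \<open>arccos\<close> lies strictly between 0 and 1,
  so \<open>arccos\<close> is a genuine inverse there and its value is acute.\<close>

lemma eventually_gamma_of:
  "\<forall>\<^sub>F \<alpha> in at_right 0. 0 < gamma_of \<alpha> \<and> gamma_of \<alpha> < pi / 2 \<and>
     cos (gamma_of \<alpha>) = 4 / 3 * cos (\<alpha> + beta_of \<alpha>)"
proof -
  let ?f = "\<lambda>\<alpha>. 4 / 3 * cos (\<alpha> + beta_of \<alpha>)"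
  have "\<forall>\<^sub>F \<alpha> in at_right 0. ?f \<alpha> / \<alpha> > 0"
    using cos_sum_beta_of_asymp by (rule order_tendstoD) simp
  moreover have "\<forall>\<^sub>F \<alpha> in at_right 0. ?f \<alpha> < 1"
    using tendsto_zero_if_quotient[OF cos_sum_beta_of_asymp] by (rule order_tendstoD) simp
  ultimately show ?thesis
    using eventually_at_right_less[of 0]
  proof eventually_elim
    case (elim \<alpha>)
    then have "0 < ?f \<alpha>" "?f \<alpha> < 1"
      by (auto simp: zero_less_divide_iff)
    then show ?case
      unfolding gamma_of_def using arccos_less_arccos[of 0 "?f \<alpha>"] arccos_less_arccos[of "?f \<alpha>" 1]
      by (auto simp: cos_arccos)
  qed
qed

lemma cos_gamma_of_asymp: "((\<lambda>\<alpha>. cos (gamma_of \<alpha>) / \<alpha>) \<longlongrightarrow> 16 / 3) (at_right 0)"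
proof -
  have "\<forall>\<^sub>F \<alpha> in at_right 0. 4 / 3 * cos (\<alpha> + beta_of \<alpha>) / \<alpha> = cos (gamma_of \<alpha>) / \<alpha>"
    using eventually_gamma_of by eventually_elim metis
  with cos_sum_beta_of_asymp show ?thesis
    by (rule Lim_transform_eventually)
qed

lemma sin_gamma_of_asymp: "((\<lambda>\<alpha>. sin (gamma_of \<alpha>)) \<longlongrightarrow> 1) (at_right 0)"
proof -
  have "((\<lambda>\<alpha>. sqrt (1 - (cos (gamma_of \<alpha>))\<^sup>2)) \<longlongrightarrow> sqrt (1 - 0\<^sup>2)) (at_right 0)"
    by (intro tendsto_intros tendsto_zero_if_quotient[OF cos_gamma_of_asymp])
  moreover have "\<forall>\<^sub>F \<alpha> in at_right 0. sqrt (1 - (cos (gamma_of \<alpha>))\<^sup>2) = sin (gamma_of \<alpha>)"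
    using eventually_gamma_of
  proof eventually_elim
    case (elim \<alpha>)
    then have "sin (gamma_of \<alpha>) \<ge> 0"
      by (intro sin_ge_zero) auto
    then show ?case
      by (simp flip: sin_squared_eq)
  qed
  ultimately show ?thesis
    by (simp add: tendsto_cong)
qed

lemma arcsin_at_right_0: "filterlim (\<lambda>\<rho>. arcsin (1 / \<rho>)) (at_right 0) at_top"
proof -
  have "((\<lambda>\<rho>::real. 1 / \<rho>) \<longlongrightarrow> 0) at_top"
    by real_asymp
  then have "((\<lambda>\<rho>. arcsin (1 / \<rho>)) \<longlongrightarrow> arcsin 0) at_top"
    by (rule isCont_tendsto_compose[rotated]) (auto intro: isCont_arcsin)
  moreover have "\<forall>\<^sub>F \<rho>::real in at_top. arcsin (1 / \<rho>) > 0"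
    using eventually_gt_at_top[of 1]
    by eventually_elim (use arcsin_less_mono[of 0] in auto)
  ultimately show ?thesis
    by (auto simp: filterlim_at elim: eventually_mono)
qed

section \<open>Small-angle expansion of one round and of the total length\<close>

text \<open>Here \<theta> is close to a right angle, and \<open>c\<close> will be 1 or 2. With the
  common denominator \<open>sin (c * \<alpha> + \<theta> \<alpha>)\<close>, which tends to 1, the
  numerator of \<open>1 - shrink\<close> is \<open>sin (c * \<alpha>) * cos (\<theta> \<alpha>) - (1
  - cos (c * \<alpha>)) * sin (\<theta> \<alpha>)\<close>; both terms are of order
  \<open>\<alpha>\<^sup>2\<close> and contribute \<open>c * k\<close> and
  \<open>c\<^sup>2 / 2\<close>.\<close>

lemma dart_asymp:
  assumes "c > 0"
    and "((\<lambda>\<alpha>. cos (\<theta> \<alpha>) / \<alpha>) \<longlongrightarrow> k) (at_right 0)" and "((\<lambda>\<alpha>. sin (\<theta> \<alpha>)) \<longlongrightarrow> 1) (at_right 0)"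
  shows "((\<lambda>\<alpha>. (1 - shrink (c * \<alpha>) (\<theta> \<alpha>)) / \<alpha>\<^sup>2) \<longlongrightarrow> c * k - c\<^sup>2 / 2) (at_right 0)"
    and "((\<lambda>\<alpha>. reach (c * \<alpha>) (\<theta> \<alpha>) / \<alpha>) \<longlongrightarrow> c) (at_right 0)"
    and "((\<lambda>\<alpha>. shrink (c * \<alpha>) (\<theta> \<alpha>)) \<longlongrightarrow> 1) (at_right 0)"
proof -
  have s0: "((\<lambda>\<alpha>::real. sin (c * \<alpha>)) \<longlongrightarrow> 0) (at_right 0)"
    and c0: "((\<lambda>\<alpha>::real. cos (c * \<alpha>)) \<longlongrightarrow> 1) (at_right 0)"
    and s1: "((\<lambda>\<alpha>::real. sin (c * \<alpha>) / \<alpha>) \<longlongrightarrow> c) (at_right 0)"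
    and c1: "((\<lambda>\<alpha>::real. (1 - cos (c * \<alpha>)) / \<alpha>\<^sup>2) \<longlongrightarrow> c\<^sup>2 / 2) (at_right 0)"
    using assms(1) by (real_asymp simp: power2_eq_square)+
  have "((\<lambda>\<alpha>. sin (c * \<alpha>) * cos (\<theta> \<alpha>) + cos (c * \<alpha>) * sin (\<theta> \<alpha>)) \<longlongrightarrow> 0 * 0 + 1 * 1) (at_right 0)"
    by (intro tendsto_intros s0 c0 assms tendsto_zero_if_quotient[OF assms(2)])
  then have lim: "((\<lambda>\<alpha>. sin (c * \<alpha> + \<theta> \<alpha>)) \<longlongrightarrow> 1) (at_right 0)"
    by (simp add: sin_add)
  then have nz: "\<forall>\<^sub>F \<alpha> in at_right 0. sin (c * \<alpha> + \<theta> \<alpha>) > 0"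
    by (rule order_tendstoD) simp
  have "((\<lambda>\<alpha>. (sin (c * \<alpha>) / \<alpha> * (cos (\<theta> \<alpha>) / \<alpha>) - (1 - cos (c * \<alpha>)) / \<alpha>\<^sup>2 * sin (\<theta> \<alpha>)) / sin (c * \<alpha> + \<theta> \<alpha>))
      \<longlongrightarrow> (c * k - c\<^sup>2 / 2 * 1) / 1) (at_right 0)"
    by (intro tendsto_intros s1 c1 assms lim) auto
  moreover have "\<forall>\<^sub>F \<alpha> in at_right 0.
      (sin (c * \<alpha>) / \<alpha> * (cos (\<theta> \<alpha>) / \<alpha>) - (1 - cos (c * \<alpha>)) / \<alpha>\<^sup>2 * sin (\<theta> \<alpha>)) / sin (c * \<alpha> + \<theta> \<alpha>) =
      (1 - shrink (c * \<alpha>) (\<theta> \<alpha>)) / \<alpha>\<^sup>2"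
    using nz eventually_at_right_less
  proof eventually_elim
    case (elim \<alpha>)
    have "1 - shrink (c * \<alpha>) (\<theta> \<alpha>) = (sin (c * \<alpha>) * cos (\<theta> \<alpha>) - (1 - cos (c * \<alpha>)) * sin (\<theta> \<alpha>)) / sin (c * \<alpha> + \<theta> \<alpha>)"
      using elim(1) by (simp add: shrink_def diff_divide_eq_iff) (simp add: sin_add algebra_simps)
    moreover have "(A / \<alpha> * (B / \<alpha>) - C / \<alpha>\<^sup>2 * D) / S = (A * B - C * D) / S / \<alpha>\<^sup>2" for A B C D S :: real
      by (simp add: power2_eq_square diff_divide_distrib mult_ac)
    ultimately show ?case
      by simp
  qed
  ultimately show "((\<lambda>\<alpha>. (1 - shrink (c * \<alpha>) (\<theta> \<alpha>)) / \<alpha>\<^sup>2) \<longlongrightarrow> c * k - c\<^sup>2 / 2) (at_right 0)"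
    by (simp add: tendsto_cong)
  have "((\<lambda>\<alpha>. sin (c * \<alpha>) / \<alpha> / sin (c * \<alpha> + \<theta> \<alpha>)) \<longlongrightarrow> c / 1) (at_right 0)"
    by (intro tendsto_intros s1 lim) auto
  then show "((\<lambda>\<alpha>. reach (c * \<alpha>) (\<theta> \<alpha>) / \<alpha>) \<longlongrightarrow> c) (at_right 0)"
    by (simp add: reach_def mult.commute)
  have "((\<lambda>\<alpha>. sin (\<theta> \<alpha>) / sin (c * \<alpha> + \<theta> \<alpha>)) \<longlongrightarrow> 1 / 1) (at_right 0)"
    by (intro tendsto_intros assms lim) auto
  then show "((\<lambda>\<alpha>. shrink (c * \<alpha>) (\<theta> \<alpha>)) \<longlongrightarrow> 1) (at_right 0)"
    by (simp add: shrink_def)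
qed

text \<open>Sum of the geometric series of round lengths, whose ratio is the product of the two
  shrink factors.\<close>

definition total_length :: "real \<Rightarrow> real \<Rightarrow> real \<Rightarrow> real \<Rightarrow> real" where
  "total_length \<rho> \<alpha> \<beta> \<gamma> = \<rho> * (reach \<alpha> \<beta> + shrink \<alpha> \<beta> * reach (2 * \<alpha>) \<gamma>) /
     (1 - shrink \<alpha> \<beta> * shrink (2 * \<alpha>) \<gamma>)"

lemma contraction_asymp:
  "((\<lambda>\<alpha>. (1 - shrink \<alpha> (beta_of \<alpha>) * shrink (2 * \<alpha>) (gamma_of \<alpha>)) / \<alpha>\<^sup>2) \<longlongrightarrow> 79 / 6) (at_right 0)"
proof -
  note b = dart_asymp[where c = 1, simplified, OF cos_beta_of_asymp sin_beta_of_asymp]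
  note g = dart_asymp[where c = 2, simplified, OF cos_gamma_of_asymp sin_gamma_of_asymp]
  \<comment> \<open>Uses \<open>1 - a * b = (1 - a) + a * (1 - b)\<close>; the constants are
    \<open>c * k - c\<^sup>2 / 2\<close> for \<open>c = 1\<close>, \<open>k = 5\<close> and for
    \<open>c = 2\<close>, \<open>k = 16 / 3\<close>.\<close>
  have "((\<lambda>\<alpha>. (1 - shrink \<alpha> (beta_of \<alpha>)) / \<alpha>\<^sup>2 +
      shrink \<alpha> (beta_of \<alpha>) * ((1 - shrink (2 * \<alpha>) (gamma_of \<alpha>)) / \<alpha>\<^sup>2)) \<longlongrightarrow>
      (5 - 1 / 2) + 1 * (32 / 3 - 2)) (at_right 0)"
    using b(1) g(1) by (intro tendsto_intros b(3)) auto
  then show ?thesis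
    by (simp add: diff_divide_distrib right_diff_distrib)
qed

lemma total_length_asymp:
  "((\<lambda>\<alpha>. total_length (1 / sin \<alpha>) \<alpha> (beta_of \<alpha>) (gamma_of \<alpha>) / (1 / sin \<alpha>)\<^sup>2) \<longlongrightarrow> 18 / 79) (at_right 0)"
proof -
  note b = dart_asymp[where c = 1, simplified, OF cos_beta_of_asymp sin_beta_of_asymp]
  note g = dart_asymp[where c = 2, simplified, OF cos_gamma_of_asymp sin_gamma_of_asymp]
  let ?D = "\<lambda>\<alpha>. 1 - shrink \<alpha> (beta_of \<alpha>) * shrink (2 * \<alpha>) (gamma_of \<alpha>)"
  \<comment> \<open>The powers of \<alpha> are distributed so that each factor has a finite limit;
    they cancel in total.\<close>
  have "((\<lambda>\<alpha>. sin \<alpha> / \<alpha> *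
        (reach \<alpha> (beta_of \<alpha>) / \<alpha> + shrink \<alpha> (beta_of \<alpha>) * (reach (2 * \<alpha>) (gamma_of \<alpha>) / \<alpha>)) / (?D \<alpha> / \<alpha>\<^sup>2))
      \<longlongrightarrow> 1 * (1 + 1 * 2) / (79 / 6)) (at_right 0)"
    by (intro tendsto_intros b(2,3) g(2) sin_over_id contraction_asymp) auto
  moreover have "\<forall>\<^sub>F \<alpha> in at_right 0. sin \<alpha> / \<alpha> *
        (reach \<alpha> (beta_of \<alpha>) / \<alpha> + shrink \<alpha> (beta_of \<alpha>) * (reach (2 * \<alpha>) (gamma_of \<alpha>) / \<alpha>)) / (?D \<alpha> / \<alpha>\<^sup>2)
      = total_length (1 / sin \<alpha>) \<alpha> (beta_of \<alpha>) (gamma_of \<alpha>) / (1 / sin \<alpha>)\<^sup>2"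
    using eventually_at_right_less[of 0]
  proof eventually_elim
    case (elim \<alpha>)
    let ?N = "reach \<alpha> (beta_of \<alpha>) + shrink \<alpha> (beta_of \<alpha>) * reach (2 * \<alpha>) (gamma_of \<alpha>)"
    have "reach \<alpha> (beta_of \<alpha>) / \<alpha> + shrink \<alpha> (beta_of \<alpha>) * (reach (2 * \<alpha>) (gamma_of \<alpha>) / \<alpha>) = ?N / \<alpha>"
      by (simp add: add_divide_distrib)
    moreover have "sin \<alpha> / \<alpha> * (?N / \<alpha>) / (?D \<alpha> / \<alpha>\<^sup>2) = sin \<alpha> * ?N / ?D \<alpha>"
      using elim by (simp add: power2_eq_square)
    \<comment> \<open>If \<open>sin \<alpha> = 0\<close>, both sides are 0 because division by 0
      gives 0.\<close>
    moreover have "total_length (1 / sin \<alpha>) \<alpha> (beta_of \<alpha>) (gamma_of \<alpha>) / (1 / sin \<alpha>)\<^sup>2 = sin \<alpha> * ?N / ?D \<alpha>"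
      by (cases "sin \<alpha> = 0") (simp_all add: total_length_def power2_eq_square)
    ultimately show ?case
      by simp
  qed
  ultimately show ?thesis
    by (simp add: tendsto_cong)
qed

section \<open>The infinite walk and its timetable\<close>

text \<open>The angle bounds make every dart a nondegenerate triangle, and
  \<open>contraction\<close> makes the round lengths summable.\<close>

locale RB_darting =
  fixes \<rho> \<alpha> \<beta> \<gamma> :: real
  assumes \<rho>: "\<rho> > 0" and \<alpha>: "\<alpha> > 0" and \<beta>: "\<beta> > 0" "\<alpha> + \<beta> < pi"
    and \<gamma>: "\<gamma> > 0" "2 * \<alpha> + \<gamma> < pi"
    and contraction: "shrink \<alpha> \<beta> * shrink (2 * \<alpha>) \<gamma> < 1"
begin

text \<open>Polar coordinates of a waypoint relative to the starting point: the modulus is free of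
  the coins, which enter only through the angle \<open>bearing\<close>.\<close>

primrec radius :: "nat \<Rightarrow> real" where
  "radius 0 = 1"
| "radius (Suc n) = radius n * (if even n then shrink \<alpha> \<beta> else shrink (2 * \<alpha>) \<gamma>)"

primrec bearing :: "(nat \<Rightarrow> bool) \<Rightarrow> nat \<Rightarrow> real" where
  "bearing c 0 = 0"
| "bearing c (Suc n) = bearing c n +
     (if even n then dir (c (n div 2)) * \<alpha> else dir (\<not> c (n div 2)) * (2 * \<alpha>))"

definition clock :: "nat \<Rightarrow> real" where
  "clock n = (\<Sum>i<n. \<rho> * radius i * (if even i then reach \<alpha> \<beta> else reach (2 * \<alpha>) \<gamma>))"

lemma factors_pos:
  "shrink \<alpha> \<beta> > 0" "shrink (2 * \<alpha>) \<gamma> > 0" "reach \<alpha> \<beta> > 0" "reach (2 * \<alpha>) \<gamma> > 0"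
  using \<alpha> \<beta> \<gamma> unfolding shrink_def reach_def by (auto intro!: divide_pos_pos sin_gt_zero)

lemma radius_pos: "radius n > 0"
  by (induction n) (simp_all add: factors_pos)

lemma waypoint_eq:
  assumes "A \<noteq> 0"
  shows "waypoint \<alpha> \<beta> \<gamma> A c n = of_real (radius n) * cis (bearing c n) * A"
proof (induction n)
  case (Suc n)
  have "of_real (radius n) * cis (bearing c n) * A \<noteq> 0"
    using radius_pos[of n] assms by simp
  then show ?case
    using \<alpha> \<beta> \<gamma> by (simp add: Suc dart_eq mult_ac flip: cis_mult)
qed simp

lemma dist_waypoint:
  assumes "norm A = \<rho>"
  shows "dist (waypoint \<alpha> \<beta> \<gamma> A c n) (waypoint \<alpha> \<beta> \<gamma> A c (Suc n)) =
    \<rho> * radius n * (if even n then reach \<alpha> \<beta> else reach (2 * \<alpha>) \<gamma>)"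
proof -
  have A: "A \<noteq> 0"
    using assms \<rho> by auto
  have *: "norm (W - of_real s * cis \<phi> * W) = norm W * norm (of_real s * cis \<phi> - 1)" for W s \<phi>
    by (subst norm_minus_commute) (simp add: algebra_simps flip: norm_mult)
  define W where "W = waypoint \<alpha> \<beta> \<gamma> A c n"
  have W: "W \<noteq> 0" "norm W = \<rho> * radius n"
    using radius_pos[of n] A assms by (auto simp: W_def waypoint_eq norm_mult)
  have d: "\<bar>dir b\<bar> = 1" for b
    by (simp add: dir_def)
  show ?thesis
    using \<alpha> \<beta> \<gamma> W
    by (simp add: dist_norm dart_eq * norm_shrink_cis_minus_1(1) d flip: W_def)
qed

text \<open>Since the timetable involves no coins, both robots always carry out moves of the same
  index.\<close>

lemma arrival_eq: "norm A = \<rho> \<Longrightarrow> arrival \<alpha> \<beta> \<gamma> A c n = clock n"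
  by (simp add: arrival_def clock_def dist_waypoint del: waypoint.simps)

lemma clock_less_Suc: "clock n < clock (Suc n)"
  using \<rho> factors_pos radius_pos by (simp add: clock_def)

lemma clock_mono: "m \<le> n \<Longrightarrow> clock m \<le> clock n"
  by (rule lift_Suc_mono_le) (auto intro: less_imp_le clock_less_Suc)

lemma clock_less: "m < n \<Longrightarrow> clock m < clock n"
  by (rule lift_Suc_mono_less[of clock]) (rule clock_less_Suc)

lemma radius_even: "radius (2 * k) = (shrink \<alpha> \<beta> * shrink (2 * \<alpha>) \<gamma>) ^ k"
  by (induction k) simp_all

lemma clock_even:
  "clock (2 * k) = total_length \<rho> \<alpha> \<beta> \<gamma> * (1 - (shrink \<alpha> \<beta> * shrink (2 * \<alpha>) \<gamma>) ^ k)"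
proof -
  define q N where "q = shrink \<alpha> \<beta> * shrink (2 * \<alpha>) \<gamma>"
    and "N = reach \<alpha> \<beta> + shrink \<alpha> \<beta> * reach (2 * \<alpha>) \<gamma>"
  have "clock (2 * k) = \<rho> * N * (\<Sum>j<k. q ^ j)"
  proof (induction k)
    case (Suc k)
    have "clock (2 * Suc k) = clock (2 * k) + \<rho> * N * q ^ k"
      using radius_even[of k] by (simp add: clock_def N_def q_def algebra_simps)
    then show ?case
      using Suc by (simp add: algebra_simps)
  qed (simp add: clock_def)
  also have "(\<Sum>j<k. q ^ j) = (1 - q ^ k) / (1 - q)"
    using contraction by (simp add: q_def sum_gp_strict)
  finally show ?thesis
    by (simp add: total_length_def q_def N_def)
qed

lemma clock_even_tendsto: "(\<lambda>k. clock (2 * k)) \<longlonglongrightarrow> total_length \<rho> \<alpha> \<beta> \<gamma>"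
proof -
  have "(\<lambda>k. (shrink \<alpha> \<beta> * shrink (2 * \<alpha>) \<gamma>) ^ k) \<longlonglongrightarrow> 0"
    using contraction factors_pos by (intro LIMSEQ_realpow_zero) (auto intro: less_imp_le)
  then have "(\<lambda>k. clock (2 * k)) \<longlonglongrightarrow> total_length \<rho> \<alpha> \<beta> \<gamma> * (1 - 0)"
    unfolding clock_even by (intro tendsto_mult tendsto_diff tendsto_const)
  then show ?thesis
    by simp
qed

lemma clock_le_total_length: "clock n \<le> total_length \<rho> \<alpha> \<beta> \<gamma>"
proof -
  have "clock n \<le> clock (2 * n)"
    by (rule clock_mono) simp
  also have "\<dots> \<le> total_length \<rho> \<alpha> \<beta> \<gamma>"
    by (rule incseq_le[OF _ clock_even_tendsto]) (auto intro!: incseq_SucI clock_mono)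
  finally show ?thesis .
qed

section \<open>Positions between waypoints\<close>

text \<open>The relation \<open>located\<close> hides the index of the move, and at a waypoint two
  indices qualify; \<open>track\<close> makes the index explicit.\<close>

definition track :: "complex \<Rightarrow> (nat \<Rightarrow> bool) \<Rightarrow> nat \<Rightarrow> real \<Rightarrow> complex" where
  "track A c n t = waypoint \<alpha> \<beta> \<gamma> A c n + (t - clock n) *\<^sub>R
     sgn (waypoint \<alpha> \<beta> \<gamma> A c (Suc n) - waypoint \<alpha> \<beta> \<gamma> A c n)"

lemma located_iff:
  "norm A = \<rho> \<Longrightarrow> located \<alpha> \<beta> \<gamma> A c t p \<longleftrightarrow>
     (\<exists>n. clock n \<le> t \<and> t \<le> clock (Suc n) \<and> p = track A c n t)"
  by (simp add: located_def track_def arrival_eq)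

text \<open>Move \<open>n\<close> has length \<open>clock (Suc n) - clock n\<close>, so walking at
  unit speed is affine interpolation, which visibly commutes with rotations about O.\<close>

lemma track_eq:
  assumes "norm A = \<rho>"
  shows "track A c n t = waypoint \<alpha> \<beta> \<gamma> A c n + ((t - clock n) / (clock (Suc n) - clock n)) *\<^sub>R
    (waypoint \<alpha> \<beta> \<gamma> A c (Suc n) - waypoint \<alpha> \<beta> \<gamma> A c n)"
proof -
  have "norm (waypoint \<alpha> \<beta> \<gamma> A c (Suc n) - waypoint \<alpha> \<beta> \<gamma> A c n) = clock (Suc n) - clock n"
    using dist_waypoint[OF assms, of c n]
    by (simp add: clock_def dist_norm norm_minus_commute del: waypoint.simps)
  then show ?thesis
    by (simp add: track_def sgn_div_norm divide_inverse del: waypoint.simps)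
qed

lemma track_clock_Suc:
  "norm A = \<rho> \<Longrightarrow> track A c n (clock (Suc n)) = waypoint \<alpha> \<beta> \<gamma> A c (Suc n)"
  using clock_less_Suc[of n] by (simp add: track_eq del: waypoint.simps)

lemma located_waypoint:
  assumes "norm A = \<rho>"
  shows "located \<alpha> \<beta> \<gamma> A c (clock n) (waypoint \<alpha> \<beta> \<gamma> A c n)"
  unfolding located_iff[OF assms]
  by (rule exI[of _ n]) (auto simp: track_def intro: less_imp_le clock_less_Suc)

text \<open>As \<open>clock\<close> is strictly increasing, two different moves can share a time
  only if they are consecutive, and then the time is their common endpoint.\<close>

lemma located_unique:
  assumes "norm A = \<rho>" "located \<alpha> \<beta> \<gamma> A c t p" "located \<alpha> \<beta> \<gamma> A c t q"
  shows "p = q"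
proof -
  have later: "track A c m t = track A c n t"
    if "m < n" "t \<le> clock (Suc m)" "clock n \<le> t" for m n
  proof -
    have "clock (Suc m) \<le> clock n"
      using that by (intro clock_mono) auto
    then have t: "t = clock (Suc m)" "clock (Suc m) = clock n"
      using that by auto
    then have "Suc m = n"
      using clock_less[of "Suc m" n] that(1) by (cases "Suc m = n") auto
    then show ?thesis
      using track_clock_Suc[OF assms(1), of c m] t by (auto simp: track_def)
  qed
  obtain m n where "clock m \<le> t" "t \<le> clock (Suc m)" "p = track A c m t"
      "clock n \<le> t" "t \<le> clock (Suc n)" "q = track A c n t"
    using assms located_iff by blast
  then show ?thesis
    using later by (metis linorder_neqE_nat)
qed

text \<open>A rotation about O fixes O, so a path through O would let the robots meet there. After
  division by the current waypoint, the imaginary part \<open>\<mu> * (s * sin \<phi>)\<close>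
  vanishes only for \<open>\<mu> = 0\<close>, where the value is 1.\<close>

lemma track_nonzero:
  assumes "norm A = \<rho>" "clock n \<le> t" "t \<le> clock (Suc n)"
  shows "track A c n t \<noteq> 0"
proof -
  have A: "A \<noteq> 0"
    using assms \<rho> by auto
  define W where "W = waypoint \<alpha> \<beta> \<gamma> A c n"
  define \<phi> s where "\<phi> = (if even n then dir (c (n div 2)) * \<alpha> else dir (\<not> c (n div 2)) * (2 * \<alpha>))"
    and "s = (if even n then shrink \<alpha> \<beta> else shrink (2 * \<alpha>) \<gamma>)"
  define \<mu> where "\<mu> = (t - clock n) / (clock (Suc n) - clock n)"
  have W: "W \<noteq> 0"
    using A radius_pos[of n] by (simp add: W_def waypoint_eq)
  have step: "waypoint \<alpha> \<beta> \<gamma> A c (Suc n) = of_real s * cis \<phi> * W"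
    using \<alpha> \<beta> \<gamma> W by (auto simp: W_def \<phi>_def s_def dart_eq)
  have track: "track A c n t = W * (1 + of_real \<mu> * (of_real s * cis \<phi> - 1))"
    unfolding track_eq[OF assms(1)] step W_def[symmetric] \<mu>_def[symmetric]
    by (simp add: scaleR_conv_of_real algebra_simps)
  have "1 + of_real \<mu> * (of_real s * cis \<phi> - 1) \<noteq> 0"
  proof
    assume eq: "1 + of_real \<mu> * (of_real s * cis \<phi> - 1) = 0"
    then have "Im (1 + of_real \<mu> * (of_real s * cis \<phi> - 1)) = 0"
      by simp
    then have "\<mu> * (s * sin \<phi>) = 0"
      by simp
    moreover have "sin \<phi> \<noteq> 0"
      using \<alpha> \<beta> \<gamma> sin_gt_zero[of \<alpha>] sin_gt_zero[of "2 * \<alpha>"] by (auto simp: \<phi>_def dir_def)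
    moreover have "s \<noteq> 0"
      using factors_pos by (auto simp: s_def)
    ultimately show False
      using eq by auto
  qed
  then show ?thesis
    using W track by simp
qed

section \<open>Effect of equal and of different coins\<close>

lemma bearing_cong: "(\<And>j. j < k \<Longrightarrow> c j = c' j) \<Longrightarrow> n \<le> 2 * k \<Longrightarrow> bearing c n = bearing c' n"
proof (induction n)
  case (Suc n)
  then have "c (n div 2) = c' (n div 2)"
    by auto
  then show ?case
    using Suc by simp
qed simp

text \<open>While the coins agree, the peer's path is the rotation of the first path by
  \<open>?r\<close>. A common point \<open>p\<close> would satisfy \<open>?r * p = p\<close> with
  \<open>p\<close> nonzero, forcing \<open>?r = 1\<close>, against
  \<open>sin (2 * \<alpha>) > 0\<close>.\<close>

lemma no_rendezvous_before:
  assumes A: "norm A = \<rho>" and same: "\<And>j. j < k \<Longrightarrow> fst \<omega> j = snd \<omega> j" and T: "T < clock (2 * k)"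
  shows "\<not> rendezvous_by \<alpha> \<beta> \<gamma> A (cis (dir d * (2 * \<alpha>)) * A) T \<omega>"
proof
  let ?r = "cis (dir d * (2 * \<alpha>))"
  have A0: "A \<noteq> 0"
    using A \<rho> by auto
  have B: "norm (?r * A) = \<rho>"
    by (simp add: norm_mult A)
  assume "rendezvous_by \<alpha> \<beta> \<gamma> A (?r * A) T \<omega>"
  then obtain t p where t: "t \<le> T" "located \<alpha> \<beta> \<gamma> A (fst \<omega>) t p"
      "located \<alpha> \<beta> \<gamma> (?r * A) (snd \<omega>) t p"
    by (auto simp: rendezvous_by_def)
  then obtain n where n: "clock n \<le> t" "t \<le> clock (Suc n)" "p = track A (fst \<omega>) n t"
    using located_iff[OF A] by blast
  \<comment> \<open>Strict inequality puts both endpoints of move \<open>n\<close>, also the one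
    with index \<open>Suc n\<close>, under the control of the first \<open>k\<close> coins.\<close>
  have "n < 2 * k"
    using clock_mono[of "2 * k" n] n t T by (cases "n < 2 * k") auto
  then have bearing: "bearing (snd \<omega>) n = bearing (fst \<omega>) n" "bearing (snd \<omega>) (Suc n) = bearing (fst \<omega>) (Suc n)"
    using bearing_cong[of k "fst \<omega>" "snd \<omega>"] same by auto
  have rot: "waypoint \<alpha> \<beta> \<gamma> (?r * A) (snd \<omega>) m = ?r * waypoint \<alpha> \<beta> \<gamma> A (fst \<omega>) m"
    if "bearing (snd \<omega>) m = bearing (fst \<omega>) m" for m
    using A0 that by (simp add: waypoint_eq mult_ac)
  have "track (?r * A) (snd \<omega>) n t = ?r * p"
    unfolding n(3) track_eq[OF A] track_eq[OF B] rot[OF bearing(1)] rot[OF bearing(2)]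
    by (simp add: algebra_simps del: waypoint.simps)
  then have "located \<alpha> \<beta> \<gamma> (?r * A) (snd \<omega>) t (?r * p)"
    using n located_iff[OF B] by metis
  then have "?r * p = p"
    using located_unique[OF B] t by blast
  moreover have "p \<noteq> 0"
    unfolding n(3) using n(1,2) by (rule track_nonzero[OF A])
  ultimately have "?r = 1"
    by simp
  then have "sin (2 * \<alpha>) = 0"
    by (auto simp: complex_eq_iff dir_def split: if_splits)
  then show False
    using sin_gt_zero[of "2 * \<alpha>"] \<alpha> \<gamma> by auto
qed

lemma rendezvous_if_coins_differ:
  assumes A: "norm A = \<rho>" and differ: "fst \<omega> k \<noteq> snd \<omega> k"
  shows "rendezvous_by \<alpha> \<beta> \<gamma> A (cis (dir d * (2 * \<alpha>)) * A) (total_length \<rho> \<alpha> \<beta> \<gamma>) \<omega>"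
proof -
  let ?r = "cis (dir d * (2 * \<alpha>))"
  have A0: "A \<noteq> 0"
    using A \<rho> by auto
  have B: "norm (?r * A) = \<rho>"
    by (simp add: norm_mult A)
  \<comment> \<open>Each bearing is measured from the robot's own starting ray, so the robots
    coincide when the bearings differ by exactly the initial offset.\<close>
  have meet: ?thesis if "bearing (fst \<omega>) n = bearing (snd \<omega>) n + dir d * (2 * \<alpha>)" for n
  proof -
    have "waypoint \<alpha> \<beta> \<gamma> A (fst \<omega>) n = waypoint \<alpha> \<beta> \<gamma> (?r * A) (snd \<omega>) n"
      using A0 by (simp add: waypoint_eq that mult_ac flip: cis_mult)
    then show ?thesis
      unfolding rendezvous_by_def
      using located_waypoint[OF A, of "fst \<omega>" n] located_waypoint[OF B, of "snd \<omega>" n]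
        clock_le_total_length by metis
  qed
  define j where "j = (LEAST j. fst \<omega> j \<noteq> snd \<omega> j)"
  have j: "fst \<omega> j \<noteq> snd \<omega> j"
    unfolding j_def using differ by (rule LeastI)
  have "bearing (fst \<omega>) (2 * j) = bearing (snd \<omega>) (2 * j)"
    by (rule bearing_cong[of j]) (use not_less_Least j_def in blast, simp)
  \<comment> \<open>In the first differing round the robots either close the angle
    \<open>2 * \<alpha>\<close> by \<alpha> each, or widen it to \<open>4 * \<alpha>\<close> and
    then close it by \<open>2 * \<alpha>\<close> each.\<close>
  then have "bearing (fst \<omega>) (2 * j + 1) = bearing (snd \<omega>) (2 * j + 1) + dir d * (2 * \<alpha>) \<or>
      bearing (fst \<omega>) (2 * j + 2) = bearing (snd \<omega>) (2 * j + 2) + dir d * (2 * \<alpha>)"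
    using j by (cases "fst \<omega> j"; cases "snd \<omega> j"; cases d) (simp_all add: dir_def)
  then show ?thesis
    using meet by blast
qed

section \<open>Value of the energy and the limit\<close>

text \<open>Coins almost surely differ at some round, which bounds the meeting time by the total
  length. Conversely agreement in the first \<open>k\<close> rounds has positive probability, so an
  admissible \<open>T\<close> is at least \<open>clock (2 * k)\<close> for every \<open>k\<close>,
  hence at least the limit.\<close>

lemma RB_energy_eq:
  assumes "1 \<le> \<rho>" "\<alpha> = half_dist_angle \<rho>"
  shows "RB_energy \<rho> \<beta> \<gamma> = ereal (total_length \<rho> \<alpha> \<beta> \<gamma>)"
  unfolding RB_energy_def
proof (rule antisym)
  let ?T = "{T. \<forall>A B. norm A = \<rho> \<and> norm B = \<rho> \<and> dist A B = 2 \<longrightarrow>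
    (AE \<omega> in fair_coins \<Otimes>\<^sub>M fair_coins. rendezvous_by (half_dist_angle \<rho>) \<beta> \<gamma> A B T \<omega>)}"
  have "total_length \<rho> \<alpha> \<beta> \<gamma> \<in> ?T"
  proof (intro CollectI allI impI)
    fix A B :: complex
    assume AB: "norm A = \<rho> \<and> norm B = \<rho> \<and> dist A B = 2"
    then obtain d where d: "B = cis (dir d * (2 * \<alpha>)) * A"
      using peer_position[OF assms(1)] assms(2) by metis
    show "AE \<omega> in fair_coins \<Otimes>\<^sub>M fair_coins.
        rendezvous_by (half_dist_angle \<rho>) \<beta> \<gamma> A B (total_length \<rho> \<alpha> \<beta> \<gamma>) \<omega>"
      using AE_coins_differ
    proof eventually_elim
      case (elim \<omega>)
      then show ?case
        unfolding d assms(2)[symmetric] using rendezvous_if_coins_differ AB by blast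
    qed
  qed
  then show "(INF T\<in>?T. ereal T) \<le> ereal (total_length \<rho> \<alpha> \<beta> \<gamma>)"
    by (rule INF_lower)
  show "ereal (total_length \<rho> \<alpha> \<beta> \<gamma>) \<le> (INF T\<in>?T. ereal T)"
  proof (rule INF_greatest)
    fix T assume T: "T \<in> ?T"
    \<comment> \<open>The condition on \<open>T\<close> quantifies over placements, so the lower
      bound needs a concrete pair at distance 2.\<close>
    define A B where "A = complex_of_real \<rho>" and "B = cis (dir True * (2 * \<alpha>)) * A"
    have AB: "norm A = \<rho>" "norm B = \<rho>"
      using \<rho> by (simp_all add: A_def B_def norm_mult)
    have "sin \<alpha> = 1 / \<rho>"
      using assms unfolding half_dist_angle_def
      by (simp, intro sin_arcsin) (auto intro: order_trans[of _ 0])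
    have "norm (cis (2 * \<alpha>) - 1) = 2 * sin \<alpha>"
    proof -
      have "(norm (cis (2 * \<alpha>) - 1))\<^sup>2 = 2 - 2 * cos (2 * \<alpha>)"
        unfolding cmod_power2 using sin_cos_squared_add3[of "2 * \<alpha>"]
        by (simp add: power2_eq_square algebra_simps)
      also have "\<dots> = (2 * sin \<alpha>)\<^sup>2"
        by (simp add: cos_double_sin power_mult_distrib)
      finally show ?thesis
        using sin_gt_zero[of \<alpha>] \<alpha> \<gamma> by (subst (asm) power2_eq_iff_nonneg) auto
    qed
    moreover have "dist A B = norm (cis (2 * \<alpha>) - 1) * norm A"
      unfolding B_def dist_norm by (subst norm_minus_commute) (simp add: dir_def algebra_simps flip: norm_mult)
    ultimately have "dist A B = 2"
      using \<open>sin \<alpha> = 1 / \<rho>\<close> AB \<rho> by simp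
    then have AE: "AE \<omega> in fair_coins \<Otimes>\<^sub>M fair_coins. rendezvous_by \<alpha> \<beta> \<gamma> A B T \<omega>"
      using T AB unfolding assms(2) by blast
    have "clock (2 * k) \<le> T" for k
    proof -
      obtain \<omega> where "rendezvous_by \<alpha> \<beta> \<gamma> A B T \<omega>" "\<And>j. j < k \<Longrightarrow> fst \<omega> j = snd \<omega> j"
        using AE_fair_coins_witness[OF AE] by metis
      then show ?thesis
        using no_rendezvous_before[OF AB(1)] unfolding B_def by (metis not_le)
    qed
    then show "ereal (total_length \<rho> \<alpha> \<beta> \<gamma>) \<le> ereal T"
      using LIMSEQ_le_const2[OF clock_even_tendsto] by auto
  qed
qed

end

lemma eventually_RB_darting:
  "\<forall>\<^sub>F \<alpha> in at_right 0. RB_darting (1 / sin \<alpha>) \<alpha> (beta_of \<alpha>) (gamma_of \<alpha>)"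
proof -
  have "\<forall>\<^sub>F \<alpha> in at_right 0. (1 - shrink \<alpha> (beta_of \<alpha>) * shrink (2 * \<alpha>) (gamma_of \<alpha>)) / \<alpha>\<^sup>2 > 0"
    using contraction_asymp by (rule order_tendstoD) simp
  \<comment> \<open>With both angles below \<open>pi / 2\<close>, this gives the two bounds by
    \<open>pi\<close> in the locale.\<close>
  moreover have "\<forall>\<^sub>F \<alpha> in at_right (0::real). \<alpha> < pi / 4"
    by (rule eventually_mono[OF eventually_at_right_real[of 0 "pi / 4"]]) auto
  ultimately show ?thesis
    using eventually_at_right_less[of 0] eventually_beta_of_pos eventually_gamma_of
  proof eventually_elim
    case (elim \<alpha>)
    then show ?case
      using beta_of_less[of \<alpha>]
      by unfold_locales (auto intro!: sin_gt_zero simp: zero_less_divide_iff)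
  qed
qed

theorem theorem7:
  fixes E :: "real \<Rightarrow> ereal"
  assumes "\<And>\<rho>. \<rho> \<ge> 1 / sin (1 / 2) \<Longrightarrow> E \<rho> = RB_energy \<rho> (beta_bar \<rho>) (gamma_bar \<rho>)"
  shows "((\<lambda>\<rho>. E \<rho> / ereal (\<rho>\<^sup>2)) \<longlongrightarrow> ereal (18 / 79)) at_top"
proof -
  have bar: "beta_bar \<rho> = beta_of (half_dist_angle \<rho>)" "gamma_bar \<rho> = gamma_of (half_dist_angle \<rho>)" for \<rho>
    unfolding beta_bar_def gamma_bar_def beta_of_def gamma_of_def Let_def by (rule refl)+
  let ?S = "\<lambda>\<alpha>. total_length (1 / sin \<alpha>) \<alpha> (beta_of \<alpha>) (gamma_of \<alpha>) / (1 / sin \<alpha>)\<^sup>2"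
  have lim: "filterlim half_dist_angle (at_right 0) at_top"
    using arcsin_at_right_0 by (simp add: half_dist_angle_def[abs_def])
  have "((\<lambda>\<rho>. ereal (?S (half_dist_angle \<rho>))) \<longlongrightarrow> ereal (18 / 79)) at_top"
    using filterlim_compose[OF total_length_asymp lim] by (rule tendsto_ereal)
  moreover have "\<forall>\<^sub>F \<rho> in at_top. ereal (?S (half_dist_angle \<rho>)) = E \<rho> / ereal (\<rho>\<^sup>2)"
    using eventually_compose_filterlim[OF eventually_RB_darting lim]
      eventually_ge_at_top[of 1] eventually_ge_at_top[of "1 / sin (1 / 2)"]
  proof eventually_elim
    case (elim \<rho>)
    \<comment> \<open>Returns from \<alpha> to \<rho>, matching the radius
      \<open>1 / sin \<alpha>\<close> used in the asymptotics.\<close>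
    have "1 / sin (half_dist_angle \<rho>) = \<rho>"
      using elim(2) unfolding half_dist_angle_def
      by (subst sin_arcsin) (auto intro: order_trans[of _ 0])
    then show ?case
      using elim RB_darting.RB_energy_eq[OF elim(1)] by (simp add: assms bar)
  qed
  ultimately show ?thesis
    by (rule Lim_transform_eventually)
qed

end
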